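(* For every positive integer $n$, $f_2(n;2) \leq \left\lceil\left(2 + \sqrt{2}\right)^n\right\rceil$.
   Context: Let $\chi:\binom{[N]}{k}\to\{1,\dots,q\}$ be a coloring of the $k$-subsets of $[N]=\{1,\dots,N\}$. A set $T\subseteq[N]$ is nonincreasing if for every $v_1<\cdots<v_{k+1}$ in $T$ we have $\chi(v_1,\dots,v_k)\ge \chi(v_2,\dots,v_{k+1})$. $f_k(n;q)$ is the minimum integer $N$ such that every coloring of the $k$-subsets of $[N]$ with colors $\{1,\dots,q\}$ contains a nonincreasing set of size $n$. *)

theory Defs
  imports Complex_Main "HOL-Library.Ramsey"
begin

definition nonincreasing_set :: "nat \<Rightarrow> (nat set \<Rightarrow> nat) \<Rightarrow> nat set \<Rightarrow> bool"
  where "nonincreasing_set k \<chi> T \<longleftrightarrow>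
    (\<forall>v :: nat \<Rightarrow> nat. strict_mono_on {1..k + 1} v \<and> v ` {1..k + 1} \<subseteq> T
       \<longrightarrow> \<chi> (v ` {1..k}) \<ge> \<chi> (v ` {2..k + 1}))"

definition forces_nonincreasing :: "nat \<Rightarrow> nat \<Rightarrow> nat \<Rightarrow> nat \<Rightarrow> bool"
  where "forces_nonincreasing k n q N \<longleftrightarrow>
    (\<forall>\<chi> \<in> [{1..N}]\<^bsup>k\<^esup> \<rightarrow> {1..q}. \<exists>T \<in> [{1..N}]\<^bsup>n\<^esup>. nonincreasing_set k \<chi> T)"

definition nonincreasing_number :: "nat \<Rightarrow> nat \<Rightarrow> nat \<Rightarrow> nat"
  where "nonincreasing_number k n q = (LEAST N. forces_nonincreasing k n q N)"

text \<open>The minimum is attained: by Ramsey's theorem a monochromatic, hence nonincreasing, set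
  of size \<open>n\<close> exists for large \<open>N\<close>.\<close>

lemma forces_nonincreasing_exists: "\<exists>N. forces_nonincreasing k n q N"
proof -
  obtain N :: nat where N: "partn_lst {..<N} (replicate q n) k"
    using ramsey_full by blast
  have "forces_nonincreasing k n q N"
    unfolding forces_nonincreasing_def
  proof
    fix \<chi> :: "nat set \<Rightarrow> nat"
    assume \<chi>: "\<chi> \<in> [{1..N}]\<^bsup>k\<^esup> \<rightarrow> {1..q}"
    define g where "g = (\<lambda>X. \<chi> (Suc ` X) - 1)"
    have Suc_img: "Suc ` X \<in> [{1..N}]\<^bsup>m\<^esup>" if "X \<in> [{..<N}]\<^bsup>m\<^esup>" for X m
      using that by (auto simp: nsets_def card_image)
    have "g \<in> [{..<N}]\<^bsup>k\<^esup> \<rightarrow> {..<q}"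
    proof
      fix X assume "X \<in> [{..<N}]\<^bsup>k\<^esup>"
      then have "\<chi> (Suc ` X) \<in> {1..q}"
        using \<chi> Suc_img by blast
      then show "g X \<in> {..<q}"
        by (auto simp: g_def)
    qed
    then obtain i H where i: "i < q" and H: "H \<in> [{..<N}]\<^bsup>n\<^esup>" and mono: "g ` [H]\<^bsup>k\<^esup> \<subseteq> {i}"
      using N by (auto simp: partn_lst_def monochromatic_def)
    have const: "\<chi> Y = Suc i" if Y: "Y \<in> [Suc ` H]\<^bsup>k\<^esup>" for Y
    proof -
      obtain X where X: "X \<subseteq> H" "Y = Suc ` X"
        using Y by (auto simp: nsets_def subset_image_iff)
      have "X \<in> [H]\<^bsup>k\<^esup>"
        using X Y by (auto simp: nsets_def card_image finite_image_iff)
      then have "g X = i"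
        using mono by blast
      moreover have "Y \<in> [{1..N}]\<^bsup>k\<^esup>"
        using Y Suc_img[OF H] by (auto simp: nsets_def)
      then have "\<chi> Y \<ge> 1"
        using \<chi> by fastforce
      ultimately show ?thesis
        using X by (simp add: g_def)
    qed
    have "nonincreasing_set k \<chi> (Suc ` H)"
      unfolding nonincreasing_set_def
    proof (intro allI impI)
      fix v :: "nat \<Rightarrow> nat"
      assume v: "strict_mono_on {1..k + 1} v \<and> v ` {1..k + 1} \<subseteq> Suc ` H"
      then have inj: "inj_on v {1..k + 1}"
        using strict_mono_on_imp_inj_on by blast
      have "v ` A \<in> [Suc ` H]\<^bsup>k\<^esup>" if "A \<subseteq> {1..k + 1}" "card A = k" for A
      proof -
        have "finite A" "card (v ` A) = k"
          using that finite_subset card_image[OF inj_on_subset[OF inj that(1)]] by auto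
        moreover have "v ` A \<subseteq> Suc ` H"
          using v that(1) by blast
        ultimately show ?thesis
          by (simp add: nsets_def)
      qed
      from this[of "{1..k}"] this[of "{2..k + 1}"]
      show "\<chi> (v ` {1..k}) \<ge> \<chi> (v ` {2..k + 1})"
        using const by simp
    qed
    then show "\<exists>T \<in> [{1..N}]\<^bsup>n\<^esup>. nonincreasing_set k \<chi> T"
      using Suc_img[OF H] by blast
  qed
  then show ?thesis ..
qed

end

theory Submission
  imports Defs
begin

text \<open>Colour 2 is called red and colour 1 blue. Any red clique followed by a blue clique is
  nonincreasing, whatever the colours between the two cliques. Cut \<open>[N]\<close> at the first \<open>m\<close> for which
  \<open>[m]\<close> contains a red clique of size \<open>k = \<lfloor>n/2\<rfloor>\<close>: then \<open>[m - 1]\<close> has no red clique of size \<open>k\<close>, and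
  \<open>[N] - [m]\<close> may be assumed to have no blue clique of size \<open>n - k\<close>. Neither part contains a
  monochromatic clique of size \<open>n\<close>, so off-diagonal Ramsey bounds apply to both, and they sum to
  about \<open>(3 * sqrt 3 / 2) ^ n\<close>, which is smaller than \<open>(2 + sqrt 2) ^ n\<close>.\<close>

text \<open>The Erdos-Szekeres bound, moved from \<open>{..<M}\<close> to an arbitrary finite
  \<open>V\<close> along an injection \<open>f\<close>. Pairs whose image lies in \<open>E\<close>
  get colour 0, so \<open>i = 0\<close> yields the clique.\<close>

lemma clique_or_indep:
  assumes "finite V" and card: "(a + b) choose a \<le> card V"
  shows "(\<exists>A\<subseteq>V. card A = a \<and> clique A E) \<or> (\<exists>B\<subseteq>V. card B = b \<and> indep B E)"
proof -
  define M where "M = (a + b) choose a"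
  obtain f where f: "inj_on f {..<M}" "f ` {..<M} \<subseteq> V"
    using card_le_inj[of "{..<M}" V] assms by (auto simp: M_def)
  define g where "g e = (if f ` e \<in> E then 0 else 1 :: nat)" for e
  have "partn_lst {..<M} [a, b] 2"
    using ramsey2_full[of 2 a b] by (simp add: ES2_choose M_def)
  moreover have "g \<in> [{..<M}]\<^bsup>2\<^esup> \<rightarrow> {..<length [a, b]}"
    by (auto simp: g_def)
  ultimately obtain i H where i: "i < length [a, b]" and H: "H \<in> [{..<M}]\<^bsup>([a, b] ! i)\<^esup>"
    and mono: "g ` [H]\<^bsup>2\<^esup> \<subseteq> {i}"
    by (rule partn_lstE) auto
  have sub: "f ` H \<subseteq> V" and card_fH: "card (f ` H) = [a, b] ! i"
    using H f by (auto simp: nsets_def card_image inj_on_subset)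
  have edge: "{f x, f y} \<in> E \<longleftrightarrow> i = 0" if "x \<in> H" "y \<in> H" "f x \<noteq> f y" for x y
  proof -
    have "g {x, y} = i"
      using that mono by (auto simp: image_subset_iff)
    then show ?thesis
      by (auto simp: g_def split: if_splits)
  qed
  show ?thesis
  proof (cases "i = 0")
    case True
    then have "clique (f ` H) E"
      using edge by (auto simp: clique_def)
    then show ?thesis
      using True sub card_fH by auto
  next
    case False
    then have "indep (f ` H) E"
      using edge by (auto simp: indep_def)
    moreover have "i = 1"
      using i False by simp
    ultimately show ?thesis
      using sub card_fH by auto
  qed
qed

lemma nonincreasing_set_2I:
  assumes "\<And>x y z. x \<in> T \<Longrightarrow> y \<in> T \<Longrightarrow> z \<in> T \<Longrightarrow> x < y \<Longrightarrow> y < z \<Longrightarrow> \<chi> {y, z} \<le> \<chi> {x, y}"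
  shows "nonincreasing_set 2 \<chi> T"
  unfolding nonincreasing_set_def
proof (intro allI impI)
  fix v :: "nat \<Rightarrow> nat"
  assume v: "strict_mono_on {1..2 + 1} v \<and> v ` {1..2 + 1} \<subseteq> T"
  then have "v 1 < v 2" "v 2 < v 3"
    by (auto intro: strict_mono_onD)
  moreover have "v 1 \<in> T" "v 2 \<in> T" "v 3 \<in> T"
    using v by (simp_all add: image_subset_iff)
  ultimately have "\<chi> {v 2, v 3} \<le> \<chi> {v 1, v 2}"
    by (intro assms)
  moreover have "{1..2} = {1, 2::nat}" "{2..2 + 1} = {2, 3::nat}"
    by auto
  ultimately show "\<chi> (v ` {2..2 + 1}) \<le> \<chi> (v ` {1..2})"
    by simp
qed

text \<open>The middle vertex decides: if \<open>y\<close> is in \<open>A\<close>, so is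
  \<open>x\<close>, and the first pair has the top colour 2; otherwise \<open>y\<close> and
  \<open>z\<close> are in \<open>B\<close>, and the second pair has the bottom colour 1.\<close>

lemma nonincreasing_set_clique_Un_indep:
  assumes \<chi>: "\<chi> \<in> [V]\<^bsup>2\<^esup> \<rightarrow> {1..2}" and V: "A \<subseteq> V" "B \<subseteq> V"
    and A: "clique A {e. \<chi> e = 2}" and B: "indep B {e. \<chi> e = 2}"
    and less: "\<And>a b. a \<in> A \<Longrightarrow> b \<in> B \<Longrightarrow> a < b"
  shows "nonincreasing_set 2 \<chi> (A \<union> B)"
proof (rule nonincreasing_set_2I)
  fix x y z
  assume mem: "x \<in> A \<union> B" "y \<in> A \<union> B" "z \<in> A \<union> B" and lt: "x < y" "y < z"
  have range: "\<chi> {p, q} \<in> {1..2}" if "p \<in> A \<union> B" "q \<in> A \<union> B" "p < q" for p q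
    using that V by (intro funcset_mem[OF \<chi>]) auto
  show "\<chi> {y, z} \<le> \<chi> {x, y}"
  proof (cases "y \<in> A")
    case True
    then have "x \<in> A"
      using mem lt less by (meson UnE less_asym)
    then have "\<chi> {x, y} = 2"
      using A True lt by (auto simp: clique_def)
    then show ?thesis
      using range[OF mem(2,3) lt(2)] by simp
  next
    case False
    then have "y \<in> B" "z \<in> B"
      using mem lt less by (blast, meson UnE less_asym)
    then have "\<chi> {y, z} \<noteq> 2"
      using B lt by (auto simp: indep_def)
    then show ?thesis
      using range[OF mem(2,3) lt(2)] range[OF mem(1,2) lt(1)] by simp
  qed
qed

lemma forces_nonincreasing_two_colors:
  assumes k: "k \<le> n"
    and N: "((k + n) choose k) + ((n + (n - k)) choose n) \<le> N"
  shows "forces_nonincreasing 2 n 2 N"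
  unfolding forces_nonincreasing_def
proof
  fix \<chi> assume \<chi>: "\<chi> \<in> [{1..N}]\<^bsup>2\<^esup> \<rightarrow> {1..2::nat}"
  define E where "E = {e. \<chi> e = 2}"
  have split: "\<exists>T \<in> [{1..N}]\<^bsup>n\<^esup>. nonincreasing_set 2 \<chi> T"
    if "A \<subseteq> {1..N}" "B \<subseteq> {1..N}" "clique A E" "indep B E"
      and less: "\<And>a b. a \<in> A \<Longrightarrow> b \<in> B \<Longrightarrow> a < b" and card: "card A + card B = n" for A B
  proof
    show "nonincreasing_set 2 \<chi> (A \<union> B)"
      using that(1-5) unfolding E_def by (rule nonincreasing_set_clique_Un_indep[OF \<chi>])
    have "finite A" "finite B"
      using that(1,2) finite_subset by blast+
    moreover have "A \<inter> B = {}"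
      using less by blast
    ultimately show "A \<union> B \<in> [{1..N}]\<^bsup>n\<^esup>"
      using that(1,2) card by (simp add: nsets_def card_Un_disjoint)
  qed
  define P where "P m \<longleftrightarrow> (\<exists>A\<subseteq>{1..m}. card A = k \<and> clique A E)" for m
  \<comment> \<open>Without a red clique of size \<open>k\<close> in \<open>{1..m}\<close>, Ramsey
    gives a blue clique of size \<open>n\<close>, which suffices with an empty red part.\<close>
  have no_red: "\<exists>T \<in> [{1..N}]\<^bsup>n\<^esup>. nonincreasing_set 2 \<chi> T"
    if m: "\<not> P m" "m \<le> N" "(k + n) choose k \<le> m" for m
  proof -
    obtain B where B: "B \<subseteq> {1..m}" "card B = n" "indep B E"
      using clique_or_indep[of "{1..m}" k n E] m by (auto simp: P_def)
    have "B \<subseteq> {1..N}"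
      using B(1) m(2) by fastforce
    then show ?thesis
      by (intro split[of "{}" B]) (use B in auto)
  qed
  show "\<exists>T \<in> [{1..N}]\<^bsup>n\<^esup>. nonincreasing_set 2 \<chi> T"
  proof (cases "P N")
    case False
    then show ?thesis
      by (rule no_red) (use N in auto)
  next
    case True
    define m where "m = (LEAST m. P m)"
    have m: "P m" "m \<le> N"
      using True unfolding m_def by (rule LeastI, rule Least_le)
    have least: "\<not> P j" if "j < m" for j
      using that unfolding m_def by (rule not_less_Least)
    obtain A where A: "A \<subseteq> {1..m}" "card A = k" "clique A E"
      using m by (auto simp: P_def)
    show ?thesis
    proof (cases "(n + (n - k)) choose n \<le> N - m")
      case True
      then consider C where "C \<subseteq> {m+1..N}" "card C = n" "clique C E"
        | B where "B \<subseteq> {m+1..N}" "card B = n - k" "indep B E"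
        using clique_or_indep[of "{m+1..N}" n "n - k" E] by auto
      then show ?thesis
      proof cases
        case 1
        then have "C \<subseteq> {1..N}"
          by fastforce
        then show ?thesis
          by (intro split[of C "{}"]) (use 1 in auto)
      next
        case 2
        show ?thesis
        proof (rule split[of A B])
          show "A \<subseteq> {1..N}" "B \<subseteq> {1..N}"
            using A 2 m by fastforce+
          show "a < b" if "a \<in> A" "b \<in> B" for a b
            using that A 2 by fastforce
          show "card A + card B = n"
            using A 2 k by simp
        qed (use A 2 in auto)
      qed
    next
      case False
      \<comment> \<open>If the right part is too short for Ramsey, the left part is long enough even
        after deleting \<open>m\<close>; by minimality of \<open>m\<close> it then contains no red
        clique of size \<open>k\<close>.\<close>
      then have "(k + n) choose k \<le> m - 1"
        using N by linarith
      moreover have "0 < (k + n) choose k"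
        by simp
      ultimately show ?thesis
        using m by (intro no_red[of "m - 1"] least) linarith+
    qed
  qed
qed

text \<open>Pascal's rule preserves the bound since 1/3 + 2/3 = 1. These weights suit a lower index
  near a third of the upper one, as for \<open>k\<close> about n/2 in
  \<open>(k + n) choose k\<close>. Writing \<open>Suc b\<close> saves a factor 3/2; it costs only
  \<open>Suc a \<le> 3 ^ a\<close> at \<open>b = 0\<close>.\<close>

lemma binomial_le_power: "real ((a + Suc b) choose a) \<le> 3 ^ a * (3/2) ^ b"
proof (induction "a + b" arbitrary: a b)
  case 0
  then show ?case by simp
next
  case (Suc s)
  show ?case
  proof (cases a)
    case 0
    then show ?thesis by simp
  next
    case a: (Suc a')
    show ?thesis
    proof (cases b)
      case 0
      have "real (Suc a) \<le> 3 ^ a"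
        by (induction a) auto
      then show ?thesis
        using 0 by simp
    next
      case b: (Suc b')
      have "real ((a + Suc b) choose a) = real ((a' + Suc b) choose a') + real ((a + Suc b') choose a)"
        using a b by simp
      also have "\<dots> \<le> 3 ^ a' * (3/2) ^ b + 3 ^ a * (3/2) ^ b'"
        using Suc.hyps(1)[of a' b] Suc.hyps(1)[of a b'] Suc.hyps(2) a b
        by (intro add_mono) simp_all
      also have "\<dots> = 3 ^ a * (3/2) ^ b"
        using a b by simp
      finally show ?thesis .
    qed
  qed
qed

lemma binomial_sum_le:
  assumes "n > 0"
  defines "k \<equiv> n div 2"
  shows "real (((k + n) choose k) + ((n + (n - k)) choose n)) \<le> (2 + sqrt 2) ^ n"
proof -
  have "(7/5) \<le> sqrt 2"
    by (rule real_le_rsqrt) (simp add: power2_eq_square)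
  then have base: "17/5 \<le> 2 + sqrt 2"
    by simp
  show ?thesis
  \<comment> \<open>For \<open>n = 1\<close> the sum is 3, but the general estimate below would give
    4, more than 2 + sqrt 2.\<close>
  proof (cases "n = 1")
    case True
    then show ?thesis
      using base by (simp add: k_def)
  next
    case False
    define i where "i = k - 1"
    have k: "k = Suc i"
      using False assms by (simp add: i_def)
    \<comment> \<open>\<open>r\<close> is the parity of \<open>n\<close>, so that
      \<open>n - k = Suc (i + r)\<close>.\<close>
    obtain r where n: "n = Suc (Suc (2 * i + r))" and r: "r = 0 \<or> r = 1"
    proof
      show "n = Suc (Suc (2 * i + n mod 2))"
        using k unfolding k_def by presburger
    qed auto
    have "((n + (n - k)) choose n) = (((n - k) + n) choose (n - k))"
      by (simp add: add.commute binomial_symmetric[of n])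
    then have "real (((k + n) choose k) + ((n + (n - k)) choose n))
        \<le> (3 ^ k + 3 ^ (n - k)) * (3/2) ^ (n - 1)"
      using binomial_le_power[of k "n - 1"] binomial_le_power[of "n - k" "n - 1"] n
      by (simp add: algebra_simps)
    also have "\<dots> = (3 + 3 ^ Suc r) * (3/2) ^ Suc r * (3 * (3/2)\<^sup>2) ^ i"
      unfolding k n power_mult_distrib
      by (simp add: algebra_simps power_add power_mult[of _ 2] flip: power_mult)
    \<comment> \<open>The prefactor is 9 for \<open>r = 0\<close> and 27 for \<open>r = 1\<close>,
      below (17/5)^2 and (17/5)^3; the growth rate 27/4 is below (17/5)^2.\<close>
    also have "\<dots> \<le> (17/5) ^ (2 + r) * ((17/5)\<^sup>2) ^ i"
      using r by (intro mult_mono power_mono) (auto simp: power2_eq_square eval_nat_numeral)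
    also have "\<dots> = (17/5) ^ n"
      by (simp add: n power_add flip: power_mult)
    also have "\<dots> \<le> (2 + sqrt 2) ^ n"
      using base by (intro power_mono) auto
    finally show ?thesis .
  qed
qed

theorem theorem4:
  fixes n :: nat
  assumes "n > 0"
  shows "int (nonincreasing_number 2 n 2) \<le> \<lceil>(2 + sqrt 2) ^ n\<rceil>"
proof -
  define k where "k = n div 2"
  define N where "N = ((k + n) choose k) + ((n + (n - k)) choose n)"
  have "forces_nonincreasing 2 n 2 N"
    by (rule forces_nonincreasing_two_colors[of k]) (auto simp: N_def k_def)
  then have "nonincreasing_number 2 n 2 \<le> N"
    unfolding nonincreasing_number_def by (rule Least_le)
  moreover have "real N \<le> (2 + sqrt 2) ^ n"
    using binomial_sum_le[OF assms] by (simp add: N_def k_def)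
  ultimately show ?thesis
    by linarith
qed

end
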